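(* Let $q$ be a prime power and $n\geq 0$. For $1\leq k\leq n+1$ let $\psi_k$ be the character of the permutation representation of $H(n+1,q)$ on $V(A_q(n+1)_k)$. Then: (i) For $1\leq k\leq n+1$ and $g\in H(n+1,q)$, $$\psi_k(g)=\begin{cases} q^{n-k+1}\binom{n}{k-1}_q & \text{if } g=I,\\ q^{n-k+1}\binom{n-1}{k-2}_q & \text{if } g\neq I.\end{cases}$$ (ii) If $\chi$ is the trivial character of $H(n+1,q)$, then $[\chi,\psi_k]=\binom{n}{k-1}_q$ for $1\leq k\leq n+1$. (iii) If $\chi$ is a nontrivial irreducible character of $H(n+1,q)$, then $[\chi,\psi_k]=\binom{n-1}{k-1}_q$ for $1\leq k\leq n+1$. (iv) For $n,k\geq 1$, $$\binom{n+1}{k}_q=\binom{n}{k}_q+\binom{n}{k-1}_q+(q^n-1)\binom{n-1}{k-1}_q,$$ with $\binom{0}{k}_q=\delta(0,k)$ and $\binom{n}{0}_q=1$.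
   Context: $\binom{n}{k}_q$ is the $q$-binomial coefficient (number of $k$-dimensional subspaces of $\mathbb{F}_q^n$), taken to be $0$ if $n<0$ or $k<0$. $\mathbb{F}_q^n$ is identified with the subspace of $\mathbb{F}_q^{n+1}$ of vectors with last coordinate $0$. $A_q(n+1)_k$ is the set of $k$-dimensional subspaces of $\mathbb{F}_q^{n+1}$ not contained in $\mathbb{F}_q^n$, and $V(A_q(n+1)_k)$ is the complex vector space with basis $A_q(n+1)_k$. $H(n+1,q)$ is the (abelian) subgroup of $GL(n+1,\mathbb{F}_q)$ of matrices $\begin{pmatrix} I & a\\ 0 & 1\end{pmatrix}$ with $I$ the $n\times n$ identity and $a\in\mathbb{F}_q^n$, acting on $A_q(n+1)_k$ by left multiplication. $[\cdot,\cdot]$ is the standard inner product of characters, $[\chi,\psi]=\frac{1}{|G|}\sum_{g}\overline{\chi(g)}\psi(g)$. *)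

theory Defs
  imports
    Complex_Main
    "HOL-Library.Cardinality"
    "HOL-Number_Theory.Prime_Powers"
    "Jordan_Normal_Form.VS_Connect"
begin

text \<open>The field \<open>\<bbbF>\<^sub>q\<close> is a type \<open>'a :: {field, finite}\<close> with \<open>CARD('a) = q\<close>;
  \<open>\<bbbF>\<^sub>q\<^sup>n\<close> is \<open>carrier_vec n\<close> with the vector space structure \<open>module_vec TYPE('a) n\<close>.\<close>

definition subspaces_of_dim :: "nat \<Rightarrow> nat \<Rightarrow> 'a::field vec set set" where
  "subspaces_of_dim n k =
    {W. VectorSpace.subspace class_ring W (module_vec TYPE('a) n) \<and>
        vectorspace.dim class_ring ((module_vec TYPE('a) n)\<lparr>carrier := W\<rparr>) = k}"

text \<open>The arguments are integers because the coefficient is also used, with value \<open>0\<close>, at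
  negative indices.\<close>

definition qbinom :: "'a::{field,finite} itself \<Rightarrow> int \<Rightarrow> int \<Rightarrow> nat" where
  "qbinom ty n k =
    (if n < 0 \<or> k < 0 then 0
     else card (subspaces_of_dim (nat n) (nat k) :: 'a vec set set))"

text \<open>\<open>Aq n k\<close> is \<open>A\<^sub>q(n+1)\<^sub>k\<close>; coordinates are numbered from \<open>0\<close>, so the last coordinate of a
  vector of \<open>\<bbbF>\<^sub>q\<^bsup>n+1\<^esup>\<close> has index \<open>n\<close>.\<close>

definition Aq :: "nat \<Rightarrow> nat \<Rightarrow> 'a::{field,finite} vec set set" where
  "Aq n k = {W \<in> subspaces_of_dim (n + 1) k. \<not> W \<subseteq> {v \<in> carrier_vec (n + 1). v $ n = 0}}"

definition GL :: "'a::field itself \<Rightarrow> nat \<Rightarrow> 'a mat monoid" where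
  "GL ty m = units_of (ring_mat TYPE('a) m ())"

text \<open>\<open>Hgrp TYPE('a) n\<close> is \<open>H(n+1,q)\<close>, with the group structure of \<open>GL(n+1,q)\<close>.\<close>

definition Hmat :: "nat \<Rightarrow> 'a::field vec \<Rightarrow> 'a mat" where
  "Hmat n a = four_block_mat (1\<^sub>m n) (mat_of_cols n [a]) (0\<^sub>m 1 n) (1\<^sub>m 1)"

definition Hgrp :: "'a::field itself \<Rightarrow> nat \<Rightarrow> 'a mat monoid" where
  "Hgrp ty n = (GL TYPE('a) (n + 1))\<lparr>carrier := Hmat n ` carrier_vec n\<rparr>"

definition representation :: "('g, 'b) monoid_scheme \<Rightarrow> nat \<Rightarrow> ('g \<Rightarrow> complex mat) \<Rightarrow> bool" where
  "representation G d \<rho> \<longleftrightarrow> \<rho> \<in> hom G (GL TYPE(complex) d)"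

definition irreducible_rep :: "('g, 'b) monoid_scheme \<Rightarrow> nat \<Rightarrow> ('g \<Rightarrow> complex mat) \<Rightarrow> bool" where
  "irreducible_rep G d \<rho> \<longleftrightarrow>
    representation G d \<rho> \<and> d > 0 \<and>
    (\<forall>W. VectorSpace.subspace class_ring W (module_vec TYPE(complex) d) \<and>
         (\<forall>g\<in>carrier G. \<forall>w\<in>W. \<rho> g *\<^sub>v w \<in> W)
       \<longrightarrow> W = {0\<^sub>v d} \<or> W = carrier_vec d)"

definition rep_char :: "('g \<Rightarrow> complex mat) \<Rightarrow> 'g \<Rightarrow> complex" where
  "rep_char \<rho> g = (\<Sum>i<dim_row (\<rho> g). \<rho> g $$ (i, i))"

definition irreducible_char :: "('g, 'b) monoid_scheme \<Rightarrow> ('g \<Rightarrow> complex) \<Rightarrow> bool" where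
  "irreducible_char G \<chi> \<longleftrightarrow>
    (\<exists>d \<rho>. irreducible_rep G d \<rho> \<and> (\<forall>g\<in>carrier G. \<chi> g = rep_char \<rho> g))"

definition trivial_char :: "'g \<Rightarrow> complex" where
  "trivial_char = (\<lambda>g. 1)"

definition char_inner ::
  "('g, 'b) monoid_scheme \<Rightarrow> ('g \<Rightarrow> complex) \<Rightarrow> ('g \<Rightarrow> complex) \<Rightarrow> complex" where
  "char_inner G \<chi> \<psi> = 1 / of_nat (Coset.order G) * (\<Sum>g\<in>carrier G. cnj (\<chi> g) * \<psi> g)"

text \<open>The permutation representation on the complex vector space with basis the finite set \<open>X\<close>,
  written as matrices with respect to that basis, listed in some fixed order: the
  \<open>j\<close>-th basis vector \<open>xs ! j\<close> is sent to the basis vector \<open>act g (xs ! j)\<close>. The order only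
  affects the matrices up to simultaneous conjugation, hence not the character.\<close>

definition perm_rep :: "('g \<Rightarrow> 'x \<Rightarrow> 'x) \<Rightarrow> 'x set \<Rightarrow> 'g \<Rightarrow> complex mat" where
  "perm_rep act X g =
    (let xs = (SOME xs. distinct xs \<and> set xs = X)
     in mat (length xs) (length xs) (\<lambda>(i, j). if act g (xs ! j) = xs ! i then 1 else 0))"

definition left_mult :: "'a::field mat \<Rightarrow> 'a vec set \<Rightarrow> 'a vec set" where
  "left_mult g W = (\<lambda>v. g *\<^sub>v v) ` W"

definition psi :: "nat \<Rightarrow> nat \<Rightarrow> 'a::{field,finite} mat \<Rightarrow> complex" where
  "psi n k = rep_char (perm_rep left_mult (Aq n k))"

end

theory Submission
  imports Defs "Jordan_Normal_Form.Spectral_Radius"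
begin

text \<open>A subspace \<open>W\<close> of \<open>\<bbbF>\<^sub>q\<^bsup>n+1\<^esup>\<close> of dimension \<open>j + 1\<close> not contained in \<open>\<bbbF>\<^sub>q\<^sup>n\<close> is determined by
  \<open>U = W \<inter> \<bbbF>\<^sub>q\<^sup>n\<close>, of dimension \<open>j\<close>, together with a coset \<open>v + U\<close>, namely the \<open>v\<close> with
  \<open>(v, 1) \<in> W\<close>; so each \<open>U\<close> comes from \<open>q\<^bsup>n-j\<^esup>\<close> subspaces \<open>W\<close>. The matrix with last column
  \<open>(a, 1)\<close> adds \<open>a\<close> to this coset, so it fixes \<open>W\<close> iff \<open>a \<in> U\<close>. Hence the permutation character
  counts subspaces of \<open>\<bbbF>\<^sub>q\<^sup>n\<close> containing \<open>a\<close>. It takes one value at \<open>a = 0\<close> and one at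
  all \<open>a \<noteq> 0\<close>, and irreducible characters of an abelian group are homomorphisms, summing to \<open>0\<close>
  when nontrivial; the inner products then reduce to two identities for the number \<open>N(n,j)\<close> of
  \<open>j\<close>-dimensional subspaces: \<open>(q\<^sup>n - 1) N(n-1,j-1) = (q\<^sup>j - 1) N(n,j)\<close>, by counting nonzero
  vectors in subspaces, and a Pascal rule.\<close>


section \<open>Cardinality and dimension of finite vector spaces\<close>

text \<open>The whole carrier is a finite spanning set, so a finite basis exists, and coordinates
  with respect to it put coefficient functions in bijection with vectors.\<close>

lemma (in vectorspace) card_carrier_eq_power_dim:
  assumes "finite (carrier V)"
  shows "card (carrier V) = card (carrier K) ^ dim"
proof -
  have "span (carrier V) = carrier V"
    using in_own_span[of "carrier V"] span_is_subset2[of "carrier V"] by auto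
  then have "fin_dim"
    unfolding fin_dim_def using assms by blast
  then obtain B where B: "finite B" "basis B"
    using finite_basis_exists by blast
  have BV: "B \<subseteq> carrier V" using B(2) by (simp add: basis_def)
  have "bij_betw (\<lambda>a. lincomb a B) (B \<rightarrow>\<^sub>E carrier K) (carrier V)"
    unfolding bij_betw_def inj_on_def
  proof (intro conjI ballI impI)
    have ex1: "\<exists>!a. a \<in> B \<rightarrow>\<^sub>E carrier K \<and> lincomb a B = v" if "v \<in> carrier V" for v
      using basis_criterion[OF B(1) BV] B(2) that by blast
    have cl: "lincomb a B \<in> carrier V" if "a \<in> B \<rightarrow>\<^sub>E carrier K" for a
      using that BV by (intro lincomb_closed) auto
    show "x = y" if "x \<in> B \<rightarrow>\<^sub>E carrier K" "y \<in> B \<rightarrow>\<^sub>E carrier K" "lincomb x B = lincomb y B" for x y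
      using ex1[OF cl[OF that(2)]] that by blast
    show "(\<lambda>a. lincomb a B) ` (B \<rightarrow>\<^sub>E carrier K) = carrier V"
      using ex1 cl by blast
  qed
  then have "card (carrier V) = card (B \<rightarrow>\<^sub>E carrier K)"
    by (simp add: bij_betw_same_card)
  also have "\<dots> = card (carrier K) ^ card B"
    by (simp add: card_PiE B(1))
  finally show ?thesis using dim_basis[OF B] by simp
qed

section \<open>Subspaces of \<open>carrier_vec n\<close>, recognised by their size\<close>

abbreviation is_subspace :: "nat \<Rightarrow> 'a::field vec set \<Rightarrow> bool" where
  "is_subspace n W \<equiv> VectorSpace.subspace class_ring W (module_vec TYPE('a) n)"

lemma is_subspace_iff:
  "is_subspace n W \<longleftrightarrow> W \<subseteq> carrier_vec n \<and> 0\<^sub>v n \<in> W \<and> (\<forall>v\<in>W. \<forall>w\<in>W. v + w \<in> W)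
     \<and> (\<forall>c. \<forall>v\<in>W. c \<cdot>\<^sub>v v \<in> W)"
  unfolding subspace_def submodule_def
  using vec_module vec_vs by (auto simp: module_vec_simps)

lemma is_subspaceD:
  assumes "is_subspace n W"
  shows "W \<subseteq> carrier_vec n" "0\<^sub>v n \<in> W" "v \<in> W \<Longrightarrow> w \<in> W \<Longrightarrow> v + w \<in> W"
    "v \<in> W \<Longrightarrow> c \<cdot>\<^sub>v v \<in> W"
  using assms by (auto simp: is_subspace_iff)

lemma is_subspace_diff:
  assumes "is_subspace n W" "v \<in> W" "w \<in> W"
  shows "v - w \<in> W"
proof -
  have "v - w = v + (-1) \<cdot>\<^sub>v w"
    using assms is_subspaceD(1)[OF assms(1)] by (intro eq_vecI) auto
  then show ?thesis using assms is_subspaceD[OF assms(1)] by metis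
qed

lemma zero_smult_vec [simp]: "v \<in> carrier_vec n \<Longrightarrow> (0::'a::mult_zero) \<cdot>\<^sub>v v = 0\<^sub>v n"
  by (intro eq_vecI) auto

lemma finite_carrier_vec: "finite (carrier_vec n :: 'a::finite vec set)"
proof -
  have "carrier_vec n \<subseteq> (vec n :: _ \<Rightarrow> 'a vec) ` ({..<n} \<rightarrow>\<^sub>E UNIV)"
  proof
    fix v :: "'a vec" assume v: "v \<in> carrier_vec n"
    then have "v = vec n (restrict (($) v) {..<n})" by (intro eq_vecI) auto
    moreover have "restrict (($) v) {..<n} \<in> {..<n} \<rightarrow>\<^sub>E UNIV" by simp
    ultimately show "v \<in> vec n ` ({..<n} \<rightarrow>\<^sub>E UNIV)" by blast
  qed
  then show ?thesis by (rule finite_subset) (intro finite_imageI finite_PiE; simp)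
qed

lemma card_carrier_vec: "card (carrier_vec n :: 'a::{field,finite} vec set) = CARD('a) ^ n"
proof -
  interpret vec_space "TYPE('a)" n .
  show ?thesis
    using card_carrier_eq_power_dim finite_carrier_vec dim_is_n by auto
qed

lemma card_subspace:
  assumes "is_subspace n (W :: 'a::{field,finite} vec set)"
  shows "card W = CARD('a) ^ vectorspace.dim class_ring ((module_vec TYPE('a) n)\<lparr>carrier := W\<rparr>)"
proof -
  interpret vec_space "TYPE('a)" n .
  interpret W: vectorspace class_ring "(module_vec TYPE('a) n)\<lparr>carrier := W\<rparr>"
    by (rule subspace_is_vs[OF assms])
  show ?thesis
    using W.card_carrier_eq_power_dim finite_subset[OF is_subspaceD(1)[OF assms] finite_carrier_vec]
    by simp
qed

lemma card_field_gt_1: "CARD('a::{field,finite}) > 1"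
proof -
  have "card {0, 1::'a} \<le> CARD('a)" by (intro card_mono) auto
  then show ?thesis by simp
qed

text \<open>As \<open>q > 1\<close>, the size \<open>q^k\<close> of a finite subspace determines
  \<open>k\<close>. All later counting therefore uses cardinality in place of
  \<open>dim\<close>.\<close>

lemma subspaces_of_dim_eq:
  "subspaces_of_dim n k = {W :: 'a::{field,finite} vec set. is_subspace n W \<and> card W = CARD('a) ^ k}"
  unfolding subspaces_of_dim_def
  using card_subspace[where n=n and 'a='a] card_field_gt_1[where 'a='a]
  by (auto simp: power_inject_exp)

lemma finite_subspaces_of_dim:
  "finite (subspaces_of_dim n k :: 'a::{field,finite} vec set set)"
  by (rule finite_subset[of _ "Pow (carrier_vec n)"])
    (auto simp: subspaces_of_dim_eq is_subspace_iff finite_carrier_vec)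

lemma subspaces_of_dim_0: "subspaces_of_dim n 0 = {{0\<^sub>v n :: 'a::{field,finite} vec}}"
proof -
  have "W = {0\<^sub>v n}" if "is_subspace n W" "card W = 1" for W :: "'a vec set"
    using that is_subspaceD(2)[OF that(1)] by (auto simp: card_1_singleton_iff)
  moreover have "is_subspace n {0\<^sub>v n :: 'a vec}"
    by (auto simp: is_subspace_iff)
  ultimately have "is_subspace n W \<and> card W = 1 \<longleftrightarrow> W = {0\<^sub>v n}" for W :: "'a vec set"
    by (metis card_1_singleton_iff One_nat_def)
  then show ?thesis
    by (simp add: subspaces_of_dim_eq)
qed

lemma subspaces_of_dim_empty:
  assumes "n < k"
  shows "(subspaces_of_dim n k :: 'a::{field,finite} vec set set) = {}"
proof -
  have "card W \<le> CARD('a) ^ n" if "is_subspace n W" for W :: "'a vec set"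
    using card_mono[OF finite_carrier_vec is_subspaceD(1)[OF that]] card_carrier_vec[where 'a='a]
    by simp
  moreover have "CARD('a) ^ n < CARD('a) ^ k"
    using assms card_field_gt_1 by (rule power_strict_increasing)
  ultimately show ?thesis by (fastforce simp: subspaces_of_dim_eq)
qed

section \<open>Splitting off the last coordinate\<close>

text \<open>The hyperplane \<open>F_q^n\<close> consists of the vectors \<open>snoc_vec u 0\<close>;
  a vector off it is a nonzero multiple of exactly one \<open>snoc_vec v 1\<close>.\<close>

definition snoc_vec :: "'a vec \<Rightarrow> 'a \<Rightarrow> 'a vec" where
  "snoc_vec u c = vec (Suc (dim_vec u)) (\<lambda>i. if i < dim_vec u then u $ i else c)"

lemma dim_snoc_vec [simp]: "dim_vec (snoc_vec u c) = Suc (dim_vec u)"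
  by (simp add: snoc_vec_def)

lemma snoc_vec_carrier [simp]: "snoc_vec u c \<in> carrier_vec (Suc n) \<longleftrightarrow> u \<in> carrier_vec n"
  unfolding carrier_dim_vec by simp

lemma snoc_vec_last [simp]: "u \<in> carrier_vec n \<Longrightarrow> snoc_vec u c $ n = c"
  by (simp add: snoc_vec_def)

lemma vec_first_snoc_vec [simp]: "u \<in> carrier_vec n \<Longrightarrow> vec_first (snoc_vec u c) n = u"
  by (intro eq_vecI) (simp_all add: snoc_vec_def vec_first_def)

lemma snoc_vec_first_last [simp]: "w \<in> carrier_vec (Suc n) \<Longrightarrow> snoc_vec (vec_first w n) (w $ n) = w"
  by (intro eq_vecI) (auto simp: snoc_vec_def vec_first_def less_Suc_eq)

lemma snoc_vec_eq_iff [simp]: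
  "u \<in> carrier_vec n \<Longrightarrow> v \<in> carrier_vec n \<Longrightarrow> snoc_vec u c = snoc_vec v d \<longleftrightarrow> u = v \<and> c = d"
  by (metis snoc_vec_last vec_first_snoc_vec)

lemma add_diff_cancel_right_vec:
  "u \<in> carrier_vec n \<Longrightarrow> v \<in> carrier_vec n \<Longrightarrow> (u + v) - v = (u :: 'a::group_add vec)"
  by (intro eq_vecI) auto

lemma snoc_vec_add:
  "u \<in> carrier_vec n \<Longrightarrow> v \<in> carrier_vec n \<Longrightarrow> snoc_vec u c + snoc_vec v d = snoc_vec (u + v) (c + d)"
  by (intro eq_vecI) (simp_all add: snoc_vec_def)

lemma snoc_vec_smult: "c \<cdot>\<^sub>v snoc_vec u d = snoc_vec (c \<cdot>\<^sub>v u) (c * d)"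
  by (intro eq_vecI) (simp_all add: snoc_vec_def)

lemma snoc_vec_zero: "snoc_vec (0\<^sub>v n) 0 = 0\<^sub>v (Suc n)"
  by (intro eq_vecI) (simp_all add: snoc_vec_def)

lemma snoc_vec_cases:
  assumes "w \<in> carrier_vec (Suc n)"
  obtains u c where "w = snoc_vec u c" "u \<in> carrier_vec n"
  using snoc_vec_first_last[OF assms] vec_first_carrier by metis

text \<open>\<open>restr n W\<close> is \<open>W \<inter> \<bbbF>\<^sub>q\<^sup>n\<close>, and \<open>glue n U v\<close> is the span of \<open>U\<close> and \<open>(v, 1)\<close>.\<close>

definition restr :: "nat \<Rightarrow> 'a::field vec set \<Rightarrow> 'a vec set" where
  "restr n W = {u \<in> carrier_vec n. snoc_vec u 0 \<in> W}"

definition glue :: "nat \<Rightarrow> 'a::field vec set \<Rightarrow> 'a vec \<Rightarrow> 'a vec set" where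
  "glue n U v = (\<lambda>(u, c). snoc_vec (u + c \<cdot>\<^sub>v v) c) ` (U \<times> UNIV)"

section \<open>Intersection with the hyperplane and extension by a vector off it\<close>

lemma is_subspace_restr:
  assumes "is_subspace (Suc n) W"
  shows "is_subspace n (restr n W)"
  unfolding is_subspace_iff
proof (intro conjI ballI allI)
  show "v + w \<in> restr n W" if "v \<in> restr n W" "w \<in> restr n W" for v w
    using that is_subspaceD(3)[OF assms, of "snoc_vec v 0" "snoc_vec w 0"]
    by (auto simp: restr_def snoc_vec_add)
  show "c \<cdot>\<^sub>v v \<in> restr n W" if "v \<in> restr n W" for c v
    using that is_subspaceD(4)[OF assms, of "snoc_vec v 0" c]
    by (auto simp: restr_def snoc_vec_smult)
qed (use is_subspaceD(2)[OF assms] in \<open>auto simp: restr_def snoc_vec_zero\<close>)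

lemma is_subspace_glue:
  assumes U: "is_subspace n U" and v: "v \<in> carrier_vec n"
  shows "is_subspace (Suc n) (glue n U v)"
  unfolding is_subspace_iff
proof (intro conjI ballI allI)
  note UD = is_subspaceD[OF U]
  show "glue n U v \<subseteq> carrier_vec (Suc n)"
    using UD(1) v by (auto simp: glue_def)
  show "0\<^sub>v (Suc n) \<in> glue n U v"
    unfolding glue_def
    by (rule image_eqI[of _ _ "(0\<^sub>v n, 0)"]) (use UD(2) v in \<open>auto simp flip: snoc_vec_zero\<close>)
  fix x assume x: "x \<in> glue n U v"
  then obtain u c where u: "u \<in> U" "x = snoc_vec (u + c \<cdot>\<^sub>v v) c" by (auto simp: glue_def)
  then have uc: "u \<in> carrier_vec n" using UD(1) by auto
  {
    fix y assume y: "y \<in> glue n U v"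
    then obtain u' c' where u': "u' \<in> U" "y = snoc_vec (u' + c' \<cdot>\<^sub>v v) c'" by (auto simp: glue_def)
    then have uc': "u' \<in> carrier_vec n" using UD(1) by auto
    have "(u + c \<cdot>\<^sub>v v) + (u' + c' \<cdot>\<^sub>v v) = (u + u') + (c + c') \<cdot>\<^sub>v v"
      using uc uc' v by (intro eq_vecI) (auto simp: algebra_simps)
    then have "x + y = snoc_vec ((u + u') + (c + c') \<cdot>\<^sub>v v) (c + c')"
      using u u' uc uc' v by (subst u(2), subst u'(2), subst snoc_vec_add[of _ n]) auto
    then show "x + y \<in> glue n U v"
      unfolding glue_def by (intro image_eqI[of _ _ "(u + u', c + c')"]) (use UD(3) u u' in auto)
  }
  fix d
  have "d \<cdot>\<^sub>v (u + c \<cdot>\<^sub>v v) = d \<cdot>\<^sub>v u + (d * c) \<cdot>\<^sub>v v"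
    using uc v by (intro eq_vecI) (auto simp: algebra_simps)
  then have "d \<cdot>\<^sub>v x = snoc_vec (d \<cdot>\<^sub>v u + (d * c) \<cdot>\<^sub>v v) (d * c)"
    using u by (simp add: snoc_vec_smult)
  then show "d \<cdot>\<^sub>v x \<in> glue n U v"
    unfolding glue_def by (intro image_eqI[of _ _ "(d \<cdot>\<^sub>v u, d * c)"]) (use UD(4) u in auto)
qed

text \<open>The last entry returns \<open>c\<close>, and cancelling
  \<open>c \<cdot>\<^sub>v v\<close> returns \<open>u\<close>, so the parametrisation is
  injective.\<close>

lemma card_glue:
  fixes U :: "'a::{field,finite} vec set"
  assumes U: "is_subspace n U" and v: "v \<in> carrier_vec n"
  shows "card (glue n U v) = CARD('a) * card U"
proof -
  have "inj_on (\<lambda>(u, c). snoc_vec (u + c \<cdot>\<^sub>v v) c) (U \<times> UNIV)"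
  proof (rule inj_onI, clarify)
    fix u c u' c' assume *: "u \<in> U" "u' \<in> U" "snoc_vec (u + c \<cdot>\<^sub>v v) c = snoc_vec (u' + c' \<cdot>\<^sub>v v) c'"
    then have uc: "u \<in> carrier_vec n" "u' \<in> carrier_vec n" using is_subspaceD(1)[OF U] by auto
    with * v have "u + c \<cdot>\<^sub>v v = u' + c' \<cdot>\<^sub>v v" "c = c'"
      by (subst (asm) snoc_vec_eq_iff[of _ n]; auto)+
    then show "u = u' \<and> c = c'"
      using uc v by (metis add_diff_cancel_right_vec smult_carrier_vec)
  qed
  then show ?thesis
    by (simp add: glue_def card_image card_cartesian_product)
qed

lemma restr_glue:
  assumes U: "is_subspace n U" and v: "v \<in> carrier_vec n"
  shows "restr n (glue n U v) = U"
proof (intro equalityI subsetI)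
  note UD = is_subspaceD(1)[OF U]
  fix x assume "x \<in> restr n (glue n U v)"
  then obtain u c where u: "x \<in> carrier_vec n" "u \<in> U" "snoc_vec x 0 = snoc_vec (u + c \<cdot>\<^sub>v v) c"
    by (auto simp: restr_def glue_def)
  moreover have "u \<in> carrier_vec n" using u UD by auto
  ultimately have "x = u + 0 \<cdot>\<^sub>v v" using v by (subst (asm) snoc_vec_eq_iff[of _ n]) auto
  then show "x \<in> U" using \<open>u \<in> carrier_vec n\<close> v u(2) by simp
next
  fix x assume x: "x \<in> U"
  then have "x \<in> carrier_vec n" using is_subspaceD(1)[OF U] by auto
  then show "x \<in> restr n (glue n U v)"
    unfolding restr_def glue_def using x v
    by (simp, intro image_eqI[of _ _ "(x, 0)"]) simp_all
qed

lemma snoc_vec_one_in_glue: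
  assumes U: "is_subspace n U" and v: "v \<in> carrier_vec n"
  shows "snoc_vec v 1 \<in> glue n U v"
  unfolding glue_def
  by (rule image_eqI[of _ _ "(0\<^sub>v n, 1)"]) (use is_subspaceD(2)[OF U] v in auto)

text \<open>A vector of \<open>W\<close> with last entry \<open>c\<close> falls into the hyperplane
  after subtracting \<open>c\<close> times \<open>snoc_vec v 1\<close>. Together with
  \<open>restr_glue\<close>, restriction and gluing are mutually inverse for fixed
  \<open>v\<close>.\<close>

lemma glue_restr:
  assumes W: "is_subspace (Suc n) W" and v: "v \<in> carrier_vec n" "snoc_vec v 1 \<in> W"
  shows "glue n (restr n W) v = W"
proof -
  note WD = is_subspaceD[OF W]
  have eq: "snoc_vec (u + c \<cdot>\<^sub>v v) c = snoc_vec u 0 + c \<cdot>\<^sub>v snoc_vec v 1" if "u \<in> carrier_vec n" for u c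
    using that v by (simp add: snoc_vec_smult snoc_vec_add[of _ n])
  show ?thesis
  proof (intro equalityI subsetI)
    fix x assume "x \<in> glue n (restr n W) v"
    then show "x \<in> W" using WD(3,4) v by (auto simp: glue_def restr_def eq)
  next
    fix x assume x: "x \<in> W"
    then obtain y c where y: "x = snoc_vec y c" "y \<in> carrier_vec n"
      using WD(1) snoc_vec_cases by blast
    have "x + (-c) \<cdot>\<^sub>v snoc_vec v 1 \<in> W" using x WD(3,4) v by auto
    moreover have "y + (-c) \<cdot>\<^sub>v v = y - c \<cdot>\<^sub>v v"
      using y v by (intro eq_vecI) auto
    ultimately have "snoc_vec (y - c \<cdot>\<^sub>v v) 0 \<in> W"
      using y v by (simp add: snoc_vec_smult snoc_vec_add[of _ n])
    then show "x \<in> glue n (restr n W) v"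
      unfolding glue_def using y v by (intro image_eqI[of _ _ "(y - c \<cdot>\<^sub>v v, c)"]) (auto simp: restr_def)
  qed
qed

section \<open>Counting subspaces by their intersection with the hyperplane\<close>

abbreviation num_subspaces :: "'a::{field,finite} itself \<Rightarrow> nat \<Rightarrow> nat \<Rightarrow> nat" where
  "num_subspaces ty n k \<equiv> card (subspaces_of_dim n k :: 'a vec set set)"

text \<open>Restriction and gluing along \<open>v\<close> are inverse bijections. The predicate
  \<open>P\<close> lets one count serve both for all subspaces and for those whose restriction
  contains a given vector.\<close>

lemma card_subspaces_containing_snoc_vec_one:
  fixes v :: "'a::{field,finite} vec"
  assumes v: "v \<in> carrier_vec n"
  shows "card {W \<in> subspaces_of_dim (Suc n) (Suc j). snoc_vec v 1 \<in> W \<and> P (restr n W)}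
    = card {U \<in> subspaces_of_dim n j. P U}"
proof (rule bij_betw_same_card, rule bij_betw_byWitness[where f = "restr n" and f' = "\<lambda>U. glue n U v"])
  have q: "CARD('a) > 0" using card_field_gt_1[where 'a='a] by simp
  show "\<forall>W\<in>{W \<in> subspaces_of_dim (Suc n) (Suc j). snoc_vec v 1 \<in> W \<and> P (restr n W)}.
      glue n (restr n W) v = W"
    using glue_restr v by (auto simp: subspaces_of_dim_eq)
  show "\<forall>U\<in>{U \<in> subspaces_of_dim n j. P U}. restr n (glue n U v) = U"
    using restr_glue v by (auto simp: subspaces_of_dim_eq)
  show "restr n ` {W \<in> subspaces_of_dim (Suc n) (Suc j). snoc_vec v 1 \<in> W \<and> P (restr n W)}
      \<subseteq> {U \<in> subspaces_of_dim n j. P U}"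
  proof (rule image_subsetI)
    fix W assume "W \<in> {W \<in> subspaces_of_dim (Suc n) (Suc j). snoc_vec v 1 \<in> W \<and> P (restr n W)}"
    then have W: "W \<in> subspaces_of_dim (Suc n) (Suc j)" "snoc_vec v 1 \<in> W" "P (restr n W)"
      by auto
    then have sub: "is_subspace (Suc n) W" and card: "card W = CARD('a) ^ Suc j"
      by (auto simp: subspaces_of_dim_eq)
    \<comment> \<open>Gluing multiplies the size by \<open>q\<close> and returns \<open>W\<close>
      here, so restricting lowers the dimension by one.\<close>
    have "CARD('a) * card (restr n W) = card W"
      using card_glue[OF is_subspace_restr[OF sub] v] glue_restr[OF sub v W(2)] by simp
    then show "restr n W \<in> {U \<in> subspaces_of_dim n j. P U}"
      using card q W(3) is_subspace_restr[OF sub] by (simp add: subspaces_of_dim_eq)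
  qed
  show "(\<lambda>U. glue n U v) ` {U \<in> subspaces_of_dim n j. P U}
      \<subseteq> {W \<in> subspaces_of_dim (Suc n) (Suc j). snoc_vec v 1 \<in> W \<and> P (restr n W)}"
    using v
    by (auto simp: subspaces_of_dim_eq is_subspace_glue card_glue snoc_vec_one_in_glue restr_glue)
qed

lemma Aq_iff:
  "W \<in> Aq n k \<longleftrightarrow> W \<in> subspaces_of_dim (Suc n) k \<and> (\<exists>v\<in>carrier_vec n. snoc_vec v 1 \<in> W)"
proof -
  have "(\<not> W \<subseteq> {v \<in> carrier_vec (n + 1). v $ n = 0}) \<longleftrightarrow> (\<exists>v\<in>carrier_vec n. snoc_vec v 1 \<in> W)"
    if W: "is_subspace (Suc n) W"
  proof
    assume "\<not> W \<subseteq> {v \<in> carrier_vec (n + 1). v $ n = 0}"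
    then obtain w where w: "w \<in> W" "w $ n \<noteq> 0" using is_subspaceD(1)[OF W] by auto
    then obtain u c where u: "w = snoc_vec u c" "u \<in> carrier_vec n"
      using is_subspaceD(1)[OF W] snoc_vec_cases by blast
    then have "inverse c \<cdot>\<^sub>v w = snoc_vec (inverse c \<cdot>\<^sub>v u) 1"
      using w by (simp add: snoc_vec_smult)
    then show "\<exists>v\<in>carrier_vec n. snoc_vec v 1 \<in> W"
      using is_subspaceD(4)[OF W w(1), of "inverse c"] u by (metis smult_carrier_vec)
  next
    assume "\<exists>v\<in>carrier_vec n. snoc_vec v 1 \<in> W"
    then show "\<not> W \<subseteq> {v \<in> carrier_vec (n + 1). v $ n = 0}" by force
  qed
  then show ?thesis by (auto simp: Aq_def subspaces_of_dim_eq)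
qed

text \<open>These \<open>v\<close> form a coset of \<open>restr n W\<close>, which has
  \<open>q^j\<close> elements.\<close>

lemma card_snoc_vec_one_in_Aq:
  fixes W :: "'a::{field,finite} vec set"
  assumes "W \<in> Aq n (Suc j)"
  shows "card {v \<in> carrier_vec n. snoc_vec v 1 \<in> W} = CARD('a) ^ j"
proof -
  obtain v where v: "v \<in> carrier_vec n" "snoc_vec v 1 \<in> W" and W: "is_subspace (Suc n) W"
    and card: "card W = CARD('a) ^ Suc j"
    using assms by (auto simp: Aq_iff subspaces_of_dim_eq)
  have "bij_betw (\<lambda>u. u + v) (restr n W) {v \<in> carrier_vec n. snoc_vec v 1 \<in> W}"
  proof (rule bij_betw_byWitness[where f' = "\<lambda>u. u - v"])
    show "(\<lambda>u. u + v) ` restr n W \<subseteq> {v \<in> carrier_vec n. snoc_vec v 1 \<in> W}"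
    proof clarify
      fix u assume "u \<in> restr n W"
      then show "u + v \<in> carrier_vec n \<and> snoc_vec (u + v) 1 \<in> W"
        using is_subspaceD(3)[OF W, of "snoc_vec u 0" "snoc_vec v 1"] v
        by (simp add: restr_def snoc_vec_add[of _ n])
    qed
    show "(\<lambda>u. u - v) ` {v \<in> carrier_vec n. snoc_vec v 1 \<in> W} \<subseteq> restr n W"
    proof clarify
      fix u assume u: "u \<in> carrier_vec n" "snoc_vec u 1 \<in> W"
      have "snoc_vec u 1 - snoc_vec v 1 = snoc_vec (u - v) 0"
        using u v by (intro eq_vecI) (auto simp: snoc_vec_def)
      then show "u - v \<in> restr n W"
        using is_subspace_diff[OF W u(2) v(2)] u v by (simp add: restr_def)
    qed
  qed (use v in \<open>auto simp: restr_def\<close>)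
  then have "card {v \<in> carrier_vec n. snoc_vec v 1 \<in> W} = card (restr n W)"
    by (simp add: bij_betw_same_card)
  moreover have "CARD('a) * card (restr n W) = CARD('a) ^ Suc j"
    using card_glue[OF is_subspace_restr[OF W] v(1)] glue_restr[OF W v] card by simp
  ultimately show ?thesis by simp
qed

lemma finite_Aq: "finite (Aq n k)"
  by (simp add: Aq_def finite_subspaces_of_dim)

text \<open>Count the pairs \<open>(W, v)\<close> with \<open>(v, 1) \<in> W\<close> in two ways.\<close>

lemma card_Aq_restr:
  fixes P :: "'a::{field,finite} vec set \<Rightarrow> bool"
  shows "CARD('a) ^ j * card {W \<in> Aq n (Suc j). P (restr n W)}
    = CARD('a) ^ n * card {U \<in> subspaces_of_dim n j. P U}"
proof -
  let ?A = "{W \<in> Aq n (Suc j). P (restr n W)}" and ?V = "carrier_vec n :: 'a vec set"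
  have "{W \<in> ?A. snoc_vec v 1 \<in> W} =
      {W \<in> subspaces_of_dim (Suc n) (Suc j). snoc_vec v 1 \<in> W \<and> P (restr n W)}" if "v \<in> ?V" for v
    using that by (auto simp: Aq_iff)
  then have *: "card {W \<in> ?A. snoc_vec v 1 \<in> W} = card {U \<in> subspaces_of_dim n j. P U}"
    if "v \<in> ?V" for v
    using that card_subspaces_containing_snoc_vec_one[of v n j P] by simp
  have "(\<Sum>W\<in>?A. card {v \<in> ?V. snoc_vec v 1 \<in> W}) = (\<Sum>v\<in>?V. card {U \<in> subspaces_of_dim n j. P U})"
    by (rule sum_multicount_gen) (use * in \<open>auto simp: finite_Aq finite_carrier_vec\<close>)
  moreover have "(\<Sum>W\<in>?A. card {v \<in> ?V. snoc_vec v 1 \<in> W}) = (\<Sum>W\<in>?A. CARD('a) ^ j)"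
    by (rule sum.cong) (auto simp: card_snoc_vec_one_in_Aq)
  ultimately show ?thesis by (simp add: card_carrier_vec mult.commute)
qed

text \<open>A subspace outside \<open>Aq\<close> has only vectors of the form
  \<open>snoc_vec u 0\<close>, so it is the embedded copy of its restriction.\<close>

lemma card_not_Aq_restr:
  fixes P :: "'a::{field,finite} vec set \<Rightarrow> bool"
  shows "card {W \<in> subspaces_of_dim (Suc n) k - Aq n k. P (restr n W)}
    = card {U \<in> subspaces_of_dim n k. P U}"
proof -
  let ?f = "\<lambda>U. (\<lambda>u. snoc_vec u 0) ` U"
  have inj: "inj_on (\<lambda>u::'a vec. snoc_vec u 0) (carrier_vec n)"
    by (auto simp: inj_on_def)
  have restr_f: "restr n (?f U) = U" if "U \<subseteq> carrier_vec n" for U :: "'a vec set"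
    using that inj by (auto simp: restr_def inj_on_def)
  have f_restr: "?f (restr n W) = W" if "W \<in> subspaces_of_dim (Suc n) k - Aq n k" for W :: "'a vec set"
  proof -
    have "W \<subseteq> {v \<in> carrier_vec (n + 1). v $ n = 0}" using that by (auto simp: Aq_def)
    then have W: "x \<in> carrier_vec (Suc n)" "x $ n = 0" if "x \<in> W" for x
      using that by auto
    have x: "x = snoc_vec (vec_first x n) 0" if "x \<in> W" for x
      using snoc_vec_first_last[OF W(1)[OF that]] W(2)[OF that] by simp
    have "vec_first x n \<in> restr n W" if "x \<in> W" for x
      using that x[OF that] by (simp add: restr_def)
    then have "x \<in> ?f (restr n W)" if "x \<in> W" for x
      using that x by blast
    then show ?thesis by (auto simp: restr_def)
  qed
  have card_restr: "card (restr n W) = card W" if "W \<in> subspaces_of_dim (Suc n) k - Aq n k" for W :: "'a vec set"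
    using card_image[OF inj_on_subset[OF inj], of "restr n W"] f_restr[OF that] by (auto simp: restr_def)
  have sub_f: "is_subspace (Suc n) (?f U)" if U: "is_subspace n U" for U :: "'a vec set"
    unfolding is_subspace_iff
  proof (intro conjI ballI allI)
    note UD = is_subspaceD[OF U]
    show "?f U \<subseteq> carrier_vec (Suc n)" using UD(1) by auto
    show "0\<^sub>v (Suc n) \<in> ?f U" using UD(2) snoc_vec_zero by (metis image_eqI)
    fix x assume "x \<in> ?f U"
    then obtain u where u: "u \<in> U" "x = snoc_vec u 0" by auto
    show "x + y \<in> ?f U" if y: "y \<in> ?f U" for y
    proof -
      obtain v where v: "v \<in> U" "y = snoc_vec v 0" using y by auto
      have "x + y = snoc_vec (u + v) 0"
        using u v UD(1) snoc_vec_add[of u n v 0 0] by auto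
      then show ?thesis using UD(3) u v by auto
    qed
    show "c \<cdot>\<^sub>v x \<in> ?f U" for c
      using u UD(4)[of u c] by (auto simp: snoc_vec_smult)
  qed
  have "bij_betw (restr n) {W \<in> subspaces_of_dim (Suc n) k - Aq n k. P (restr n W)}
      {U \<in> subspaces_of_dim n k. P U}"
  proof (rule bij_betw_byWitness[where f' = ?f])
    show "\<forall>W\<in>{W \<in> subspaces_of_dim (Suc n) k - Aq n k. P (restr n W)}. ?f (restr n W) = W"
      using f_restr by blast
    show "\<forall>U\<in>{U \<in> subspaces_of_dim n k. P U}. restr n (?f U) = U"
      using restr_f by (auto simp: subspaces_of_dim_eq dest: is_subspaceD(1))
    show "restr n ` {W \<in> subspaces_of_dim (Suc n) k - Aq n k. P (restr n W)} \<subseteq> {U \<in> subspaces_of_dim n k. P U}"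
    proof (rule image_subsetI)
      fix W assume "W \<in> {W \<in> subspaces_of_dim (Suc n) k - Aq n k. P (restr n W)}"
      then show "restr n W \<in> {U \<in> subspaces_of_dim n k. P U}"
        using card_restr[of W] is_subspace_restr[where n = n and W = W] by (auto simp: subspaces_of_dim_eq)
    qed
    show "?f ` {U \<in> subspaces_of_dim n k. P U} \<subseteq> {W \<in> subspaces_of_dim (Suc n) k - Aq n k. P (restr n W)}"
    proof (intro subsetI, elim imageE)
      fix W U assume U: "U \<in> {U \<in> subspaces_of_dim n k. P U}" "W = ?f U"
      then have sub: "is_subspace n U" and card: "card U = CARD('a) ^ k" and "P U"
        by (auto simp: subspaces_of_dim_eq)
      note UD = is_subspaceD(1)[OF sub]
      have "W \<in> subspaces_of_dim (Suc n) k"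
        using sub_f[OF sub] card card_image[OF inj_on_subset[OF inj UD]] U(2)
        by (simp add: subspaces_of_dim_eq)
      moreover have "W \<notin> Aq n k"
        using UD U(2) by (force simp: Aq_def)
      ultimately show "W \<in> {W \<in> subspaces_of_dim (Suc n) k - Aq n k. P (restr n W)}"
        using restr_f[OF UD] U(2) \<open>P U\<close> by simp
    qed
  qed
  then show ?thesis by (rule bij_betw_same_card)
qed

text \<open>Every \<open>W\<close> either lies in the hyperplane or belongs to \<open>Aq\<close>.
  The factor \<open>q^j\<close> on both sides stands in for the weight \<open>q^(n-j)\<close>, so
  that \<open>j > n\<close> is covered as well.\<close>

lemma card_subspaces_split:
  fixes P :: "'a::{field,finite} vec set \<Rightarrow> bool"
  shows "CARD('a) ^ j * card {W \<in> subspaces_of_dim (Suc n) (Suc j). P (restr n W)}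
    = CARD('a) ^ n * card {U \<in> subspaces_of_dim n j. P U}
      + CARD('a) ^ j * card {U \<in> subspaces_of_dim n (Suc j). P U}"
proof -
  let ?S = "subspaces_of_dim (Suc n) (Suc j) :: 'a vec set set"
  have "{W \<in> ?S. P (restr n W)} =
      {W \<in> Aq n (Suc j). P (restr n W)} \<union> {W \<in> ?S - Aq n (Suc j). P (restr n W)}"
    by (auto simp: Aq_def)
  then have "card {W \<in> ?S. P (restr n W)} =
      card {W \<in> Aq n (Suc j). P (restr n W)} + card {W \<in> ?S - Aq n (Suc j). P (restr n W)}"
    by (simp only:) (rule card_Un_disjoint, auto simp: finite_Aq finite_subspaces_of_dim)
  then show ?thesis
    by (simp only: card_not_Aq_restr distrib_left card_Aq_restr)
qed

section \<open>Identities for the number of subspaces\<close>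

lemma num_subspaces_pascal:
  "CARD('a) ^ j * num_subspaces TYPE('a::{field,finite}) (Suc n) (Suc j)
    = CARD('a) ^ n * num_subspaces TYPE('a) n j + CARD('a) ^ j * num_subspaces TYPE('a) n (Suc j)"
  using card_subspaces_split[where P = "\<lambda>_. True" and 'a='a] by simp

lemma card_subspaces_containing_last_nonzero:
  fixes b :: "'a::{field,finite} vec"
  assumes b: "b \<in> carrier_vec n" and c: "c \<noteq> 0"
  shows "card {U \<in> subspaces_of_dim (Suc n) (Suc j). snoc_vec b c \<in> U} = num_subspaces TYPE('a) n j"
proof -
  let ?v = "inverse c \<cdot>\<^sub>v b"
  have scale: "snoc_vec ?v 1 = inverse c \<cdot>\<^sub>v snoc_vec b c" "snoc_vec b c = c \<cdot>\<^sub>v snoc_vec ?v 1"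
    using b c by (simp_all add: snoc_vec_smult smult_smult_assoc)
  have "snoc_vec b c \<in> U \<longleftrightarrow> snoc_vec ?v 1 \<in> U" if U: "is_subspace (Suc n) U" for U
    using is_subspaceD(4)[OF U] scale by metis
  then have "{U \<in> subspaces_of_dim (Suc n) (Suc j). snoc_vec b c \<in> U} =
      {U \<in> subspaces_of_dim (Suc n) (Suc j). snoc_vec ?v 1 \<in> U}"
    by (auto simp: subspaces_of_dim_eq)
  then show ?thesis
    using card_subspaces_containing_snoc_vec_one[of ?v n j "\<lambda>_. True"] b by simp
qed

text \<open>Induction on the dimension. If the last entry of \<open>a\<close> is nonzero, the gluing
  bijection applies. If it is \<open>0\<close>, then \<open>a = snoc_vec b 0\<close> lies in
  \<open>W\<close> iff \<open>b\<close> lies in the restriction, so splitting by the hyperplane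
  reduces to \<open>b\<close>, and the Pascal rule recombines the terms.\<close>

lemma card_subspaces_containing:
  fixes a :: "'a::{field,finite} vec"
  assumes "a \<in> carrier_vec (Suc n)" "a \<noteq> 0\<^sub>v (Suc n)"
  shows "card {U \<in> subspaces_of_dim (Suc n) (Suc j). a \<in> U} = num_subspaces TYPE('a) n j"
  using assms
proof (induction n arbitrary: a j)
  case (0 a j)
  then obtain b c where a: "a = snoc_vec b c" "b \<in> carrier_vec 0" using snoc_vec_cases by blast
  then have "b = 0\<^sub>v 0" by auto
  then have "c \<noteq> 0" using 0 a snoc_vec_zero[of 0] by metis
  then show ?case using a card_subspaces_containing_last_nonzero by blast
next
  case (Suc m a j)
  then obtain b c where a: "a = snoc_vec b c" "b \<in> carrier_vec (Suc m)" using snoc_vec_cases by blast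
  show ?case
  proof (cases "c = 0")
    case False
    then show ?thesis using a card_subspaces_containing_last_nonzero by blast
  next
    case True
    with a Suc.prems have b: "b \<noteq> 0\<^sub>v (Suc m)" using snoc_vec_zero[of "Suc m"] by metis
    let ?C = "\<lambda>j. card {U \<in> subspaces_of_dim (Suc m) j. b \<in> U}"
    have "a \<in> W \<longleftrightarrow> b \<in> restr (Suc m) W" for W
      using a True by (simp add: restr_def)
    then have split: "CARD('a) ^ j * card {W \<in> subspaces_of_dim (Suc (Suc m)) (Suc j). a \<in> W} =
        CARD('a) ^ Suc m * ?C j + CARD('a) ^ j * num_subspaces TYPE('a) m j"
      using card_subspaces_split[of j "Suc m" "\<lambda>U. b \<in> U"] Suc.IH[OF a(2) b] by simp
    \<comment> \<open>The induction hypothesis covers positive dimensions only. For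
      \<open>j = 0\<close> the zero subspace misses \<open>b\<close>; otherwise it evaluates
      \<open>?C j\<close>, and the claim is the Pascal rule times \<open>q\<close>.\<close>
    have "CARD('a) ^ Suc m * ?C j + CARD('a) ^ j * num_subspaces TYPE('a) m j =
        CARD('a) ^ j * num_subspaces TYPE('a) (Suc m) j"
    proof (cases j)
      case 0
      have "{U \<in> subspaces_of_dim (Suc m) 0. b \<in> U} = {}" using b by (auto simp: subspaces_of_dim_0)
      then have "?C 0 = 0" by (metis card.empty)
      then show ?thesis using 0 by (simp add: subspaces_of_dim_0)
    next
      case (Suc i)
      have "CARD('a) * (CARD('a) ^ i * num_subspaces TYPE('a) (Suc m) (Suc i)) =
        CARD('a) * (CARD('a) ^ m * num_subspaces TYPE('a) m i + CARD('a) ^ i * num_subspaces TYPE('a) m (Suc i))"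
        by (simp only: num_subspaces_pascal)
      then show ?thesis using Suc.IH[OF a(2) b] Suc by (simp add: algebra_simps)
    qed
    with split have "CARD('a) ^ j * card {W \<in> subspaces_of_dim (Suc (Suc m)) (Suc j). a \<in> W} =
        CARD('a) ^ j * num_subspaces TYPE('a) (Suc m) j" by simp
    then show ?thesis by simp
  qed
qed

text \<open>Double counting of pairs of a nonzero vector and a subspace through it: by
  \<open>card_subspaces_containing\<close> each such vector lies in equally many subspaces, and each
  subspace has \<open>q^(j+1) - 1\<close> nonzero vectors.\<close>

lemma num_subspaces_absorption:
  "(CARD('a) ^ Suc n - 1) * num_subspaces TYPE('a::{field,finite}) n j
    = (CARD('a) ^ Suc j - 1) * num_subspaces TYPE('a) (Suc n) (Suc j)"
proof -
  let ?V = "carrier_vec (Suc n) - {0\<^sub>v (Suc n)} :: 'a vec set"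
  let ?S = "subspaces_of_dim (Suc n) (Suc j) :: 'a vec set set"
  have "card {v \<in> ?V. v \<in> U} = CARD('a) ^ Suc j - 1" if "U \<in> ?S" for U
  proof -
    have U: "is_subspace (Suc n) U" "card U = CARD('a) ^ Suc j"
      using that by (auto simp: subspaces_of_dim_eq)
    have "{v \<in> ?V. v \<in> U} = U - {0\<^sub>v (Suc n)}" using is_subspaceD(1)[OF U(1)] by auto
    then show ?thesis using is_subspaceD(2)[OF U(1)] U(2) by simp
  qed
  then have "(\<Sum>v\<in>?V. card {U \<in> ?S. v \<in> U}) = (\<Sum>U\<in>?S. CARD('a) ^ Suc j - 1)"
    by (intro sum_multicount_gen) (auto simp: finite_carrier_vec finite_subspaces_of_dim)
  moreover have "(\<Sum>v\<in>?V. card {U \<in> ?S. v \<in> U}) = (\<Sum>v\<in>?V. num_subspaces TYPE('a) n j)"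
    by (rule sum.cong) (auto simp: card_subspaces_containing)
  moreover have "card ?V = CARD('a) ^ Suc n - 1"
    by (simp add: finite_carrier_vec card_Diff_singleton card_carrier_vec)
  ultimately show ?thesis by (simp add: mult.commute)
qed

text \<open>Powers of \<open>q\<close> are positive, so the truncated subtraction is exact and ring
  algebra over the integers becomes available.\<close>

lemma num_subspaces_absorption_int:
  "(int CARD('a) ^ Suc n - 1) * int (num_subspaces TYPE('a::{field,finite}) n j)
    = (int CARD('a) ^ Suc j - 1) * int (num_subspaces TYPE('a) (Suc n) (Suc j))"
proof -
  have "int (CARD('a) ^ m - 1) = int CARD('a) ^ m - 1" for m
    using card_field_gt_1[where 'a='a] by (simp add: of_nat_diff)
  then show ?thesis
    using num_subspaces_absorption[of n j, where 'a='a] by (metis of_nat_mult)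
qed

text \<open>Eliminating \<open>q^(n+1) N(n,j)\<close> between \<open>num_subspaces_pascal\<close>
  and the absorption identity gives this companion rule, with the power of \<open>q\<close> on the
  other term.\<close>

lemma num_subspaces_pascal':
  "num_subspaces TYPE('a::{field,finite}) (Suc n) (Suc j)
    = num_subspaces TYPE('a) n j + CARD('a) ^ Suc j * num_subspaces TYPE('a) n (Suc j)"
proof -
  let ?q = "int CARD('a)" and ?N = "\<lambda>n j. int (num_subspaces TYPE('a) n j)"
  have 1: "?q ^ j * ?N (Suc n) (Suc j) = ?q ^ n * ?N n j + ?q ^ j * ?N n (Suc j)"
    using num_subspaces_pascal[of j n, where 'a='a]
    by (simp flip: of_nat_mult of_nat_add of_nat_power del: of_nat_mult of_nat_add of_nat_power)
  have 2: "(?q ^ Suc n - 1) * ?N n j = (?q ^ Suc j - 1) * ?N (Suc n) (Suc j)"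
    by (rule num_subspaces_absorption_int)
  \<comment> \<open>The extra factor \<open>q\<close> turns \<open>q^n\<close> into the
    \<open>q^(n+1)\<close> of the absorption identity.\<close>
  have 3: "?q * (?q ^ j * ?N (Suc n) (Suc j)) = ?q * (?q ^ n * ?N n j + ?q ^ j * ?N n (Suc j))"
    by (simp only: 1)
  have "?N (Suc n) (Suc j) = ?N n j + ?q ^ Suc j * ?N n (Suc j)"
    using 2 3 by (simp add: algebra_simps)
  then have "int (num_subspaces TYPE('a) (Suc n) (Suc j))
    = int (num_subspaces TYPE('a) n j + CARD('a) ^ Suc j * num_subspaces TYPE('a) n (Suc j))" by simp
  then show ?thesis by (simp only: of_nat_eq_iff)
qed

text \<open>Compared with the Pascal rule, only the weight of \<open>N(m+1,j)\<close> differs;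
  \<open>key\<close> converts the excess \<open>q^(m+1) - q^j\<close> into the term with
  \<open>N(m,j)\<close>. Summed over all dimensions this is the Goldman-Rota recurrence for the
  total number of subspaces.\<close>

lemma num_subspaces_goldman_rota:
  "int (num_subspaces TYPE('a::{field,finite}) (Suc (Suc m)) (Suc j)) =
    int (num_subspaces TYPE('a) (Suc m) (Suc j)) + int (num_subspaces TYPE('a) (Suc m) j)
    + (int CARD('a) ^ Suc m - 1) * int (num_subspaces TYPE('a) m j)"
proof -
  let ?q = "int CARD('a)" and ?N = "\<lambda>n j. int (num_subspaces TYPE('a) n j)"
  have q: "?q \<noteq> 0" using card_field_gt_1[where 'a='a] by simp
  have pascal: "?q ^ j * ?N (Suc n) (Suc j) = ?q ^ n * ?N n j + ?q ^ j * ?N n (Suc j)" for n j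
    using num_subspaces_pascal[of j n, where 'a='a]
    by (simp flip: of_nat_mult of_nat_add of_nat_power del: of_nat_mult of_nat_add of_nat_power)
  have key: "?q ^ Suc m * ?N (Suc m) j = ?q ^ j * ?N (Suc m) j + ?q ^ j * ((?q ^ Suc m - 1) * ?N m j)"
  proof (cases j)
    case 0
    then show ?thesis by (simp add: subspaces_of_dim_0)
  next
    case (Suc i)
    have 1: "?N (Suc m) (Suc i) = ?N m i + ?q ^ Suc i * ?N m (Suc i)"
      by (simp add: num_subspaces_pascal'[where 'a='a])
    have 2: "(?q ^ Suc m - 1) * ?N m i = (?q ^ Suc i - 1) * ?N (Suc m) (Suc i)"
      by (rule num_subspaces_absorption_int)
    \<comment> \<open>The companion Pascal rule is multiplied by \<open>q^(m+1) - 1\<close>;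
      absorption then replaces the term in \<open>N(m,i)\<close> by one in
      \<open>N(m+1,i+1)\<close>.\<close>
    have "?q ^ Suc i * ((?q ^ Suc m - 1) * ?N m (Suc i)) = (?q ^ Suc m - 1) * (?N (Suc m) (Suc i) - ?N m i)"
      using 1 by (simp add: algebra_simps)
    also have "\<dots> = (?q ^ Suc m - 1) * ?N (Suc m) (Suc i) - (?q ^ Suc i - 1) * ?N (Suc m) (Suc i)"
      using 2 by (simp add: right_diff_distrib)
    finally show ?thesis using Suc by (simp add: algebra_simps)
  qed
  have "?q ^ j * ?N (Suc (Suc m)) (Suc j) =
      ?q ^ j * (?N (Suc m) (Suc j) + ?N (Suc m) j + (?q ^ Suc m - 1) * ?N m j)"
    using pascal[of j "Suc m"] key by (simp add: distrib_left)
  then show ?thesis using q by simp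
qed

section \<open>Traces of permutation matrices\<close>

text \<open>A diagonal entry is \<open>1\<close> exactly at a fixed point. The sum over positions is
  a sum over \<open>X\<close>, so the enumeration picked by \<open>SOME\<close> is
  immaterial.\<close>

lemma rep_char_perm_rep:
  assumes "finite X"
  shows "rep_char (perm_rep act X) g = of_nat (card {x \<in> X. act g x = x})"
proof -
  define xs where "xs = (SOME xs. distinct xs \<and> set xs = X)"
  have "distinct xs \<and> set xs = X"
    unfolding xs_def by (rule someI_ex) (use finite_distinct_list[OF assms] in blast)
  then have xs: "distinct xs" "set xs = X" by auto
  have "rep_char (perm_rep act X) g = (\<Sum>i<length xs. if act g (xs ! i) = xs ! i then 1 else 0)"
    by (simp add: rep_char_def perm_rep_def Let_def flip: xs_def)
  also have "\<dots> = (\<Sum>x\<in>X. if act g x = x then 1 else 0)"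
    by (rule sum.reindex_bij_betw[OF bij_betw_nth[OF xs(1)]]) (use xs in auto)
  also have "\<dots> = of_nat (card {x \<in> X. act g x = x})"
    using assms by (simp add: sum.If_cases Int_def)
  finally show ?thesis .
qed

section \<open>The group \<open>Hgrp\<close> and its action on subspaces\<close>

lemma Hmat_carrier [simp]: "Hmat n a \<in> carrier_mat (Suc n) (Suc n)"
  unfolding Hmat_def by (metis Suc_eq_plus1 four_block_carrier_mat one_carrier_mat)

lemma Hmat_index:
  assumes "i < Suc n" "j < Suc n" "a \<in> carrier_vec n"
  shows "Hmat n a $$ (i, j) = (if i = j then 1 else if j = n then a $ i else 0)"
  using assms by (auto simp: Hmat_def mat_of_cols_index less_Suc_eq)

text \<open>The action is affine: the hyperplane \<open>c = 0\<close> is fixed pointwise and the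
  slice \<open>c = 1\<close> is translated by \<open>a\<close>.\<close>

lemma Hmat_mult_snoc_vec:
  fixes a :: "'a::field vec"
  assumes a: "a \<in> carrier_vec n" and u: "u \<in> carrier_vec n"
  shows "Hmat n a *\<^sub>v snoc_vec u c = snoc_vec (u + c \<cdot>\<^sub>v a) c"
proof (rule eq_vecI)
  have dim: "dim_row (Hmat n a) = Suc n" "dim_col (Hmat n a) = Suc n"
    using Hmat_carrier[of n a] by (auto simp del: Hmat_carrier)
  show "dim_vec (Hmat n a *\<^sub>v snoc_vec u c) = dim_vec (snoc_vec (u + c \<cdot>\<^sub>v a) c)"
    using dim a u by simp
  fix i assume "i < dim_vec (snoc_vec (u + c \<cdot>\<^sub>v a) c)"
  then have i: "i < Suc n" using a by simp
  have sn: "snoc_vec u c $ j = (if j < n then u $ j else c)" if "j < Suc n" for j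
    using u that by (auto simp: snoc_vec_def)
  have "(Hmat n a *\<^sub>v snoc_vec u c) $ i = (\<Sum>j<Suc n. Hmat n a $$ (i, j) * snoc_vec u c $ j)"
    using dim i u by (simp add: scalar_prod_def atLeast0LessThan)
  also have "\<dots> = (\<Sum>j<n. if i = j then u $ j else 0) + (if i = n then c else a $ i * c)"
    using i a by (simp add: Hmat_index sn if_distrib[of "\<lambda>x. x * _"] cong: if_cong)
  also have "\<dots> = snoc_vec (u + c \<cdot>\<^sub>v a) c $ i"
    using i a u by (auto simp: snoc_vec_def less_Suc_eq)
  finally show "(Hmat n a *\<^sub>v snoc_vec u c) $ i = snoc_vec (u + c \<cdot>\<^sub>v a) c $ i" .
qed

lemma Hmat_zero: "Hmat n (0\<^sub>v n) = 1\<^sub>m (Suc n)"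
  by (rule eq_matI) (auto simp: Hmat_index carrier_matD[OF Hmat_carrier])

lemma Hmat_inj: "inj_on (Hmat n) (carrier_vec n)"
proof (rule inj_onI)
  fix a b :: "'a vec"
  assume ab: "a \<in> carrier_vec n" "b \<in> carrier_vec n" "Hmat n a = Hmat n b"
  then have "snoc_vec (0\<^sub>v n + 1 \<cdot>\<^sub>v a) 1 = snoc_vec (0\<^sub>v n + 1 \<cdot>\<^sub>v b) 1"
    by (metis Hmat_mult_snoc_vec zero_carrier_vec)
  moreover have "0\<^sub>v n + 1 \<cdot>\<^sub>v a = a" "0\<^sub>v n + 1 \<cdot>\<^sub>v b = b"
    using ab(1,2) by (auto intro!: eq_vecI)
  ultimately show "a = b" using snoc_vec_eq_iff[OF ab(1,2)] by metis
qed

text \<open>With \<open>Hmat_inj\<close>, this identifies the group with the additive group of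
  \<open>carrier_vec n\<close>, where commutativity and sums over the group are handled.\<close>

lemma Hmat_mult:
  fixes a b :: "'a::field vec"
  assumes "a \<in> carrier_vec n" "b \<in> carrier_vec n"
  shows "Hmat n a * Hmat n b = Hmat n (a + b)"
proof -
  have "mat_of_cols n [b] + mat_of_cols n [a] = mat_of_cols n [a + b]"
    using assms by (intro eq_matI) (auto simp: mat_of_cols_index add.commute)
  then show ?thesis
    unfolding Hmat_def using assms
    by (subst mult_four_block_mat[of _ n n _ 1 _ 1 _ _ n _ 1]) auto
qed

lemma Hgrp_carrier: "carrier (Hgrp TYPE('a::field) n) = Hmat n ` carrier_vec n"
  by (simp add: Hgrp_def)

lemma Hgrp_mult: "x \<otimes>\<^bsub>Hgrp TYPE('a::field) n\<^esub> y = x * y"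
  by (simp add: Hgrp_def GL_def units_of_def ring_mat_simps)

lemma order_Hgrp: "Coset.order (Hgrp TYPE('a::{field,finite}) n) = CARD('a) ^ n"
  by (simp add: Coset.order_def Hgrp_carrier card_image[OF Hmat_inj] card_carrier_vec)

text \<open>The image of \<open>snoc_vec v 1\<close> differs from it by \<open>snoc_vec a 0\<close>,
  which gives one direction; conversely every vector of \<open>W\<close> is moved by a multiple of
  \<open>snoc_vec a 0\<close>.\<close>

lemma left_mult_Hmat_fixes_iff:
  fixes W :: "'a::{field,finite} vec set"
  assumes W: "W \<in> Aq n k" and a: "a \<in> carrier_vec n"
  shows "left_mult (Hmat n a) W = W \<longleftrightarrow> a \<in> restr n W"
proof
  have sub: "is_subspace (Suc n) W" using W by (auto simp: Aq_iff subspaces_of_dim_eq)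
  note WD = is_subspaceD[OF sub]
  obtain v where v: "v \<in> carrier_vec n" "snoc_vec v 1 \<in> W" using W by (auto simp: Aq_iff)
  {
    assume "left_mult (Hmat n a) W = W"
    then have "Hmat n a *\<^sub>v snoc_vec v 1 \<in> W" using v by (auto simp: left_mult_def)
    then have "snoc_vec (v + a) 1 - snoc_vec v 1 \<in> W"
      using is_subspace_diff[OF sub _ v(2)] a v Hmat_mult_snoc_vec[of a n v 1] by simp
    moreover have "snoc_vec (v + a) 1 - snoc_vec v 1 = snoc_vec a 0"
      using a v by (intro eq_vecI) (auto simp: snoc_vec_def)
    ultimately show "a \<in> restr n W" using a by (simp add: restr_def)
  next
    assume aW: "a \<in> restr n W"
    \<comment> \<open>\<open>d\<close> is left free: \<open>d = c\<close> keeps images in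
      \<open>W\<close>, and \<open>d = -c\<close> provides preimages.\<close>
    have shift: "snoc_vec (u + d \<cdot>\<^sub>v a) c \<in> W" if "snoc_vec u c \<in> W" "u \<in> carrier_vec n" for u c d
    proof -
      have "snoc_vec u c + d \<cdot>\<^sub>v snoc_vec a 0 \<in> W"
        using that aW WD(3,4) by (auto simp: restr_def)
      then show ?thesis using that a by (simp add: snoc_vec_smult snoc_vec_add[of _ n])
    qed
    show "left_mult (Hmat n a) W = W"
    proof (intro equalityI subsetI)
      fix x assume "x \<in> left_mult (Hmat n a) W"
      then obtain w where w: "w \<in> W" "x = Hmat n a *\<^sub>v w" by (auto simp: left_mult_def)
      then obtain u c where u: "w = snoc_vec u c" "u \<in> carrier_vec n"
        using WD(1) snoc_vec_cases by blast
      then show "x \<in> W" using w shift Hmat_mult_snoc_vec[OF a] by simp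
    next
      fix w assume w: "w \<in> W"
      then obtain u c where u: "w = snoc_vec u c" "u \<in> carrier_vec n"
        using WD(1) snoc_vec_cases by blast
      let ?u = "u + (- c) \<cdot>\<^sub>v a"
      have "?u + c \<cdot>\<^sub>v a = u" using u a by (intro eq_vecI) auto
      then have "w = Hmat n a *\<^sub>v snoc_vec ?u c"
        using u a Hmat_mult_snoc_vec[OF a, of ?u c] by simp
      moreover have "snoc_vec ?u c \<in> W" using shift w u by simp
      ultimately show "w \<in> left_mult (Hmat n a) W" by (auto simp: left_mult_def)
    qed
  }
qed

section \<open>Character values in terms of \<open>qbinom\<close>\<close>

lemma qbinom_nat: "qbinom TYPE('a::{field,finite}) (int n) (int k) = num_subspaces TYPE('a) n k"
  by (simp add: qbinom_def)

text \<open>For \<open>j = 0\<close> both sides vanish, the right one by the convention on negative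
  indices; a nonzero \<open>a\<close> forces \<open>n \<ge> 1\<close>.\<close>

lemma card_subspaces_containing_qbinom:
  fixes a :: "'a::{field,finite} vec"
  assumes "a \<in> carrier_vec n" "a \<noteq> 0\<^sub>v n"
  shows "card {U \<in> subspaces_of_dim n j. a \<in> U} = qbinom TYPE('a) (int n - 1) (int j - 1)"
proof (cases j)
  case 0
  have "{U \<in> subspaces_of_dim n 0. a \<in> U} = {}" using assms by (auto simp: subspaces_of_dim_0)
  then have "card {U \<in> subspaces_of_dim n 0. a \<in> U} = 0" by (simp only: card.empty)
  then show ?thesis using 0 by (simp add: qbinom_def)
next
  case (Suc i)
  obtain m where m: "n = Suc m" using assms by (cases n) auto
  then show ?thesis using Suc card_subspaces_containing[of a m i] assms qbinom_nat[of m i, where 'a='a] by simp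
qed

text \<open>The fixed points are the members of \<open>Aq\<close> whose restriction contains
  \<open>a\<close>. Writing \<open>k\<close> as \<open>Suc j\<close> turns the exponent
  \<open>n - k + 1\<close> into \<open>n - j\<close>.\<close>

lemma psi_Hmat:
  fixes a :: "'a::{field,finite} vec"
  assumes a: "a \<in> carrier_vec n" and j: "j \<le> n"
  shows "psi n (Suc j) (Hmat n a) = of_nat (CARD('a) ^ (n - j) *
    (if a = 0\<^sub>v n then qbinom TYPE('a) (int n) (int j) else qbinom TYPE('a) (int n - 1) (int j - 1)))"
proof -
  have "CARD('a) ^ j * card {W \<in> Aq n (Suc j). a \<in> restr n W} =
      CARD('a) ^ j * (CARD('a) ^ (n - j) * card {U \<in> subspaces_of_dim n j. a \<in> U})"
    using card_Aq_restr[of j n "\<lambda>U. a \<in> U"] j by (simp flip: mult.assoc power_add)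
  then have *: "card {W \<in> Aq n (Suc j). a \<in> restr n W} =
      CARD('a) ^ (n - j) * card {U \<in> subspaces_of_dim n j. a \<in> U}" by simp
  have "psi n (Suc j) (Hmat n a) = of_nat (card {W \<in> Aq n (Suc j). left_mult (Hmat n a) W = W})"
    unfolding psi_def by (rule rep_char_perm_rep[OF finite_Aq])
  also have "{W \<in> Aq n (Suc j). left_mult (Hmat n a) W = W} = {W \<in> Aq n (Suc j). a \<in> restr n W}"
    using left_mult_Hmat_fixes_iff[OF _ a] by blast
  finally have psi: "psi n (Suc j) (Hmat n a) =
      of_nat (CARD('a) ^ (n - j) * card {U \<in> subspaces_of_dim n j. a \<in> U})" by (simp only: *)
  show ?thesis
  proof (cases "a = 0\<^sub>v n")
    case True
    then have "{U \<in> subspaces_of_dim n j. a \<in> U} = subspaces_of_dim n j"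
      by (auto simp: subspaces_of_dim_eq dest: is_subspaceD(2))
    then show ?thesis using psi True by (simp add: qbinom_nat)
  next
    case False
    then show ?thesis using psi card_subspaces_containing_qbinom[OF a False, of j] by simp
  qed
qed

lemma qbinom_absorption:
  assumes "j \<le> n"
  shows "(int CARD('a) ^ n - 1) * int (qbinom TYPE('a::{field,finite}) (int n - 1) (int j - 1))
    = (int CARD('a) ^ j - 1) * int (qbinom TYPE('a) (int n) (int j))"
proof (cases j)
  \<comment> \<open>The left side is \<open>0\<close> by the convention on negative indices, the
    right side because \<open>q^0 = 1\<close>.\<close>
  case 0
  then show ?thesis by (simp add: qbinom_def)
next
  case (Suc i)
  then obtain m where m: "n = Suc m" using assms by (cases n) auto
  show ?thesis
    using num_subspaces_absorption_int[of m i, where 'a='a] qbinom_nat[of "Suc m" "Suc i", where 'a='a]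
      qbinom_nat[of m i, where 'a='a] Suc m by simp
qed

text \<open>Supplies, for \<open>n = Suc m\<close>, the difference
  \<open>N(n,j) - N(n-1,j-1)\<close> that survives in the inner product with a nontrivial
  character.\<close>

lemma qbinom_pascal:
  "qbinom TYPE('a::{field,finite}) (int (Suc m)) (int j) =
    qbinom TYPE('a) (int m) (int j - 1) + CARD('a) ^ j * qbinom TYPE('a) (int m) (int j)"
proof (cases j)
  case 0
  then show ?thesis by (simp add: qbinom_def subspaces_of_dim_0)
next
  case (Suc i)
  then show ?thesis
    using num_subspaces_pascal'[of m i, where 'a='a] qbinom_nat[of "Suc m" "Suc i", where 'a='a]
      qbinom_nat[of m "Suc i", where 'a='a] qbinom_nat[of m i, where 'a='a] by simp
qed

section \<open>Irreducible characters of commutative groups\<close>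

lemma carrier_GL: "A \<in> carrier (GL TYPE('a::field) d) \<longleftrightarrow>
    A \<in> carrier_mat d d \<and> (\<exists>B\<in>carrier_mat d d. B * A = 1\<^sub>m d \<and> A * B = 1\<^sub>m d)"
  by (auto simp: GL_def units_of_def Units_def ring_mat_simps)

lemma mult_GL: "x \<otimes>\<^bsub>GL TYPE('a::field) d\<^esub> y = x * y"
  by (simp add: GL_def units_of_def ring_mat_simps)

lemma representationD:
  assumes "representation G d \<rho>"
  shows "g \<in> carrier G \<Longrightarrow> \<rho> g \<in> carrier_mat d d"
    and "g \<in> carrier G \<Longrightarrow> \<exists>B\<in>carrier_mat d d. \<rho> g * B = 1\<^sub>m d"
    and "g \<in> carrier G \<Longrightarrow> h \<in> carrier G \<Longrightarrow> \<rho> (g \<otimes>\<^bsub>G\<^esub> h) = \<rho> g * \<rho> h"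
  using assms carrier_GL[where 'a=complex and d=d] mult_GL[where 'a=complex and d=d]
  by (auto simp: representation_def hom_def Pi_def)

text \<open>Schur's lemma: an eigenspace of \<open>\<rho> g\<close> is invariant, so every \<open>\<rho> g\<close> is scalar and hence
  every coordinate line is invariant.\<close>

lemma irreducible_rep_comm_degree:
  assumes irr: "irreducible_rep G d \<rho>"
    and comm: "\<And>g h. g \<in> carrier G \<Longrightarrow> h \<in> carrier G \<Longrightarrow> g \<otimes>\<^bsub>G\<^esub> h = h \<otimes>\<^bsub>G\<^esub> g"
  shows "d = 1"
proof -
  have rep: "representation G d \<rho>" and d: "d > 0"
    and inv: "\<And>W. is_subspace d W \<Longrightarrow> (\<And>g w. g \<in> carrier G \<Longrightarrow> w \<in> W \<Longrightarrow> \<rho> g *\<^sub>v w \<in> W)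
        \<Longrightarrow> W = {0\<^sub>v d} \<or> W = carrier_vec d"
    using irr by (auto simp: irreducible_rep_def)
  note rho = representationD(1)[OF rep]
  have scalar: "\<exists>c. \<forall>w\<in>carrier_vec d. \<rho> g *\<^sub>v w = c \<cdot>\<^sub>v w" if g: "g \<in> carrier G" for g
  proof -
    \<comment> \<open>An eigenvalue exists because the entries are complex and
      \<open>d > 0\<close>.\<close>
    obtain c where "c \<in> spectrum (\<rho> g)" using spectrum_non_empty[OF rho[OF g] d] by auto
    then obtain v where v: "eigenvector (\<rho> g) v c" by (auto simp: spectrum_def eigenvalue_def)
    have dim: "dim_row (\<rho> g) = d" using rho[OF g] by auto
    let ?W = "{w \<in> carrier_vec d. \<rho> g *\<^sub>v w = c \<cdot>\<^sub>v w}"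
    have "is_subspace d ?W"
      unfolding is_subspace_iff
      using rho[OF g] by (auto simp: mult_add_distrib_mat_vec[OF rho[OF g]] smult_add_distrib_vec[of _ d]
          mult_mat_vec[OF rho[OF g]] smult_smult_assoc mult.commute)
    moreover have "\<rho> h *\<^sub>v w \<in> ?W" if h: "h \<in> carrier G" and w: "w \<in> ?W" for h w
    proof -
      have wc: "w \<in> carrier_vec d" "\<rho> g *\<^sub>v w = c \<cdot>\<^sub>v w" using w by auto
      have "\<rho> g * \<rho> h = \<rho> h * \<rho> g"
        using representationD(3)[OF rep] comm g h by metis
      then have "\<rho> g *\<^sub>v (\<rho> h *\<^sub>v w) = \<rho> h *\<^sub>v (\<rho> g *\<^sub>v w)"
        using assoc_mult_mat_vec[OF rho[OF g] rho[OF h] wc(1)]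
          assoc_mult_mat_vec[OF rho[OF h] rho[OF g] wc(1)] by simp
      also have "\<dots> = c \<cdot>\<^sub>v (\<rho> h *\<^sub>v w)"
        using wc mult_mat_vec[OF rho[OF h] wc(1)] by simp
      finally show ?thesis using mult_mat_vec_carrier[OF rho[OF h] wc(1)] by simp
    qed
    ultimately have "?W = {0\<^sub>v d} \<or> ?W = carrier_vec d" by (rule inv)
    moreover have "v \<in> ?W" "v \<noteq> 0\<^sub>v d"
      using v by (auto simp: eigenvector_def dim)
    ultimately show ?thesis by blast
  qed
  let ?L = "{w \<in> carrier_vec d. \<forall>i<d. i \<noteq> 0 \<longrightarrow> w $ i = (0::complex)}"
  have "is_subspace d ?L" by (auto simp: is_subspace_iff)
  moreover have "\<rho> g *\<^sub>v w \<in> ?L" if "g \<in> carrier G" "w \<in> ?L" for g w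
  proof -
    obtain c where "\<rho> g *\<^sub>v w = c \<cdot>\<^sub>v w" using \<open>w \<in> ?L\<close> scalar[OF \<open>g \<in> carrier G\<close>] by blast
    then show ?thesis using \<open>w \<in> ?L\<close> by auto
  qed
  ultimately have "?L = {0\<^sub>v d} \<or> ?L = carrier_vec d" by (rule inv)
  moreover have "unit_vec d 0 \<in> ?L" by auto
  moreover have "unit_vec d 0 \<noteq> (0\<^sub>v d :: complex vec)" using unit_vec_nonzero[OF d] .
  ultimately have L: "?L = carrier_vec d" by auto
  show "d = 1"
  proof (rule ccontr)
    assume "d \<noteq> 1"
    then have "1 < d" using d by simp
    moreover have "unit_vec d 1 \<in> ?L" using L by auto
    ultimately show False by auto
  qed
qed

text \<open>In degree one the character is the single matrix entry, hence multiplicative, and it is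
  nonzero because the matrix is invertible. The hypotheses \<open>comm\<close> and
  \<open>closed\<close> are what \<open>Hmat_mult\<close> supplies for \<open>Hgrp\<close>.\<close>

lemma irreducible_char_comm:
  assumes "irreducible_char G \<chi>"
    and comm: "\<And>g h. g \<in> carrier G \<Longrightarrow> h \<in> carrier G \<Longrightarrow> g \<otimes>\<^bsub>G\<^esub> h = h \<otimes>\<^bsub>G\<^esub> g"
    and closed: "\<And>g h. g \<in> carrier G \<Longrightarrow> h \<in> carrier G \<Longrightarrow> g \<otimes>\<^bsub>G\<^esub> h \<in> carrier G"
  shows "g \<in> carrier G \<Longrightarrow> h \<in> carrier G \<Longrightarrow> \<chi> (g \<otimes>\<^bsub>G\<^esub> h) = \<chi> g * \<chi> h"
    and "g \<in> carrier G \<Longrightarrow> \<chi> g \<noteq> 0"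
proof -
  obtain d \<rho> where irr: "irreducible_rep G d \<rho>" and chi: "\<And>g. g \<in> carrier G \<Longrightarrow> \<chi> g = rep_char \<rho> g"
    using assms(1) by (auto simp: irreducible_char_def)
  have d: "d = 1" using irreducible_rep_comm_degree[OF irr comm] .
  have rep: "representation G 1 \<rho>" using irr d by (simp add: irreducible_rep_def)
  note rho = representationD[OF rep]
  have chi': "\<chi> g = \<rho> g $$ (0, 0)" if "g \<in> carrier G" for g
    using chi[OF that] rho(1)[OF that] by (simp add: rep_char_def)
  have mult: "(A * B) $$ (0, 0) = A $$ (0, 0) * B $$ (0, 0)"
    if "A \<in> carrier_mat 1 1" "B \<in> carrier_mat 1 1" for A B :: "complex mat"
    using that by (simp add: scalar_prod_def)
  show "\<chi> (g \<otimes>\<^bsub>G\<^esub> h) = \<chi> g * \<chi> h" if "g \<in> carrier G" "h \<in> carrier G"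
    using chi'[OF closed[OF that]] chi'[OF that(1)] chi'[OF that(2)] rho(3)[OF that]
      mult[OF rho(1)[OF that(1)] rho(1)[OF that(2)]] by simp
  show "\<chi> g \<noteq> 0" if g: "g \<in> carrier G"
  proof -
    obtain B where B: "B \<in> carrier_mat 1 1" "\<rho> g * B = 1\<^sub>m 1" using rho(2)[OF g] by auto
    then have "\<rho> g $$ (0, 0) * B $$ (0, 0) = 1" using mult[OF rho(1)[OF g] B(1)] by simp
    then show ?thesis using chi'[OF g] by auto
  qed
qed

text \<open>The value at the identity is nonzero and equals its own square. If \<open>\<chi>\<close>
  differs from \<open>1\<close> at \<open>b\<close>, translating by \<open>b\<close> multiplies the
  sum by that value, so the sum is \<open>0\<close>.\<close>

lemma irreducible_char_Hgrp:
  fixes \<chi> :: "'a::{field,finite} mat \<Rightarrow> complex"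
  assumes irr: "irreducible_char (Hgrp TYPE('a) n) \<chi>"
  shows "\<chi> (Hmat n (0\<^sub>v n)) = 1"
    and "\<not> (\<forall>g\<in>carrier (Hgrp TYPE('a) n). \<chi> g = 1) \<Longrightarrow> (\<Sum>a\<in>carrier_vec n. \<chi> (Hmat n a)) = 0"
proof -
  let ?G = "Hgrp TYPE('a) n" and ?f = "\<lambda>a. \<chi> (Hmat n a)"
  have comm: "g \<otimes>\<^bsub>?G\<^esub> h = h \<otimes>\<^bsub>?G\<^esub> g" and closed: "g \<otimes>\<^bsub>?G\<^esub> h \<in> carrier ?G"
    if "g \<in> carrier ?G" "h \<in> carrier ?G" for g h
    using that by (auto simp: Hgrp_carrier Hgrp_mult Hmat_mult comm_add_vec)
  have in_G: "Hmat n a \<in> carrier ?G" if "a \<in> carrier_vec n" for a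
    using that by (auto simp: Hgrp_carrier)
  have mult: "?f (a + b) = ?f a * ?f b" if "a \<in> carrier_vec n" "b \<in> carrier_vec n" for a b
    using irreducible_char_comm(1)[OF irr comm closed in_G[OF that(1)] in_G[OF that(2)]] that
    by (simp add: Hgrp_mult Hmat_mult)
  have "?f (0\<^sub>v n) \<noteq> 0"
    using irreducible_char_comm(2)[OF irr comm closed in_G] by simp
  then show "?f (0\<^sub>v n) = 1"
    using mult[of "0\<^sub>v n" "0\<^sub>v n"] by simp
  assume "\<not> (\<forall>g\<in>carrier ?G. \<chi> g = 1)"
  then obtain b where b: "b \<in> carrier_vec n" "?f b \<noteq> 1" by (auto simp: Hgrp_carrier)
  have "bij_betw (\<lambda>a. a + b) (carrier_vec n) (carrier_vec n)"
    by (rule bij_betw_byWitness[where f' = "\<lambda>a. a - b"]) (use b in auto)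
  then have "(\<Sum>a\<in>carrier_vec n. ?f a) = (\<Sum>a\<in>carrier_vec n. ?f (a + b))"
    by (rule sum.reindex_bij_betw[symmetric])
  also have "\<dots> = (\<Sum>a\<in>carrier_vec n. ?f a) * ?f b"
    unfolding sum_distrib_right using mult b by (intro sum.cong) auto
  finally show "(\<Sum>a\<in>carrier_vec n. ?f a) = 0" using b by simp
qed

section \<open>Inner products and the four assertions\<close>

text \<open>Up to the factor \<open>q^(n-j)\<close>, the permutation character is a constant
  \<open>M\<close> plus \<open>N - M\<close> at the identity. Only \<open>\<chi>\<close> at the
  identity and its full sum then enter, so trivial and nontrivial characters are treated
  together.\<close>

lemma char_inner_psi:
  fixes \<chi> :: "'a::{field,finite} mat \<Rightarrow> complex"
  assumes j: "j \<le> n" and one: "\<chi> (Hmat n (0\<^sub>v n)) = 1"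
  shows "char_inner (Hgrp TYPE('a) n) \<chi> (psi n (Suc j)) =
    (of_nat (qbinom TYPE('a) (int n) (int j)) - of_nat (qbinom TYPE('a) (int n - 1) (int j - 1))
      + of_nat (qbinom TYPE('a) (int n - 1) (int j - 1)) * cnj (\<Sum>a\<in>carrier_vec n. \<chi> (Hmat n a)))
    / of_nat CARD('a) ^ j"
proof -
  let ?V = "carrier_vec n :: 'a vec set" and ?q = "of_nat CARD('a) :: complex"
  let ?N = "of_nat (qbinom TYPE('a) (int n) (int j)) :: complex"
  let ?M = "of_nat (qbinom TYPE('a) (int n - 1) (int j - 1)) :: complex"
  have q: "?q \<noteq> 0" by simp
  have "(\<Sum>g\<in>carrier (Hgrp TYPE('a) n). cnj (\<chi> g) * psi n (Suc j) g)
      = (\<Sum>a\<in>?V. cnj (\<chi> (Hmat n a)) * psi n (Suc j) (Hmat n a))"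
    by (simp add: Hgrp_carrier sum.reindex[OF Hmat_inj])
  also have "\<dots> = (\<Sum>a\<in>?V. ?q ^ (n - j) * ((if a = 0\<^sub>v n then ?N - ?M else 0) + ?M * cnj (\<chi> (Hmat n a))))"
    by (rule sum.cong) (auto simp: psi_Hmat j one algebra_simps)
  also have "\<dots> = ?q ^ (n - j) * ((?N - ?M) + ?M * cnj (\<Sum>a\<in>?V. \<chi> (Hmat n a)))"
    by (simp add: sum.distrib finite_carrier_vec flip: sum_distrib_left)
  finally have "char_inner (Hgrp TYPE('a) n) \<chi> (psi n (Suc j)) =
      ?q ^ (n - j) * ((?N - ?M) + ?M * cnj (\<Sum>a\<in>?V. \<chi> (Hmat n a))) / ?q ^ n"
    by (simp add: char_inner_def order_Hgrp)
  also have "?q ^ n = ?q ^ (n - j) * ?q ^ j" using j by (simp flip: power_add)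
  finally show ?thesis using q by simp
qed

theorem theorem2p3:
  fixes q n :: nat
  assumes "primepow q" and "CARD('a::{field,finite}) = q"
  shows
    "(\<forall>k\<in>{1..n+1}. \<forall>g\<in>carrier (Hgrp TYPE('a) n).
        psi n k g =
          (if g = 1\<^sub>m (n + 1)
           then of_nat (q ^ (n + 1 - k) * qbinom TYPE('a) (int n) (int k - 1))
           else of_nat (q ^ (n + 1 - k) * qbinom TYPE('a) (int n - 1) (int k - 2))))
     \<and> (\<forall>k\<in>{1..n+1}.
        char_inner (Hgrp TYPE('a) n) trivial_char (psi n k) =
          of_nat (qbinom TYPE('a) (int n) (int k - 1)))
     \<and> (\<forall>\<chi>. irreducible_char (Hgrp TYPE('a) n) \<chi>
            \<and> \<not> (\<forall>g\<in>carrier (Hgrp TYPE('a) n). \<chi> g = trivial_char g) \<longrightarrow>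
        (\<forall>k\<in>{1..n+1}.
          char_inner (Hgrp TYPE('a) n) \<chi> (psi n k) =
            of_nat (qbinom TYPE('a) (int n - 1) (int k - 1))))
     \<and> (\<forall>k::nat. n \<ge> 1 \<and> k \<ge> 1 \<longrightarrow>
        int (qbinom TYPE('a) (int n + 1) (int k)) =
          int (qbinom TYPE('a) (int n) (int k))
          + int (qbinom TYPE('a) (int n) (int k - 1))
          + (int q ^ n - 1) * int (qbinom TYPE('a) (int n - 1) (int k - 1)))
     \<and> (\<forall>k::nat. qbinom TYPE('a) 0 (int k) = (if k = 0 then 1 else 0))
     \<and> qbinom TYPE('a) (int n) 0 = 1"
proof (intro conjI ballI allI impI)
  have q: "q = CARD('a)" using assms(2) by simp
  let ?q = "of_nat CARD('a) :: complex"
  have q0: "?q \<noteq> 0" by simp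
  {
    fix k g assume k: "k \<in> {1..n+1}" and g: "g \<in> carrier (Hgrp TYPE('a) n)"
    obtain j where j: "k = Suc j" "j \<le> n" using k by (cases k) auto
    obtain a where a: "a \<in> carrier_vec n" "g = Hmat n a" using g by (auto simp: Hgrp_carrier)
    have "g = 1\<^sub>m (n + 1) \<longleftrightarrow> a = 0\<^sub>v n"
      using a inj_onD[OF Hmat_inj, of n a "0\<^sub>v n"] Hmat_zero[of n, where 'a='a] by auto
    then show "psi n k g = (if g = 1\<^sub>m (n + 1)
           then of_nat (q ^ (n + 1 - k) * qbinom TYPE('a) (int n) (int k - 1))
           else of_nat (q ^ (n + 1 - k) * qbinom TYPE('a) (int n - 1) (int k - 2)))"
      using psi_Hmat[OF a(1) j(2)] a(2) j(1) q by simp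
  next
    fix k assume k: "k \<in> {1..n+1}"
    obtain j where j: "k = Suc j" "j \<le> n" using k by (cases k) auto
    let ?N = "qbinom TYPE('a) (int n) (int j)"
    let ?M = "qbinom TYPE('a) (int n - 1) (int j - 1)"
    \<comment> \<open>The sum of the trivial character is \<open>q^n\<close>; absorption, cast to
      the complex numbers, rewrites \<open>N - M + q^n M\<close> as \<open>q^j N\<close>.\<close>
    have "of_int ((int CARD('a) ^ n - 1) * int ?M) = (of_int ((int CARD('a) ^ j - 1) * int ?N) :: complex)"
      by (simp only: qbinom_absorption[OF j(2)])
    then have *: "(?q ^ n - 1) * of_nat ?M = (?q ^ j - 1) * of_nat ?N" by simp
    have "char_inner (Hgrp TYPE('a) n) trivial_char (psi n (Suc j)) =
        (of_nat ?N - of_nat ?M + of_nat ?M * ?q ^ n) / ?q ^ j"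
      by (subst char_inner_psi[OF j(2)]) (simp_all add: trivial_char_def card_carrier_vec)
    also have "of_nat ?N - of_nat ?M + of_nat ?M * ?q ^ n = ?q ^ j * of_nat ?N"
      using * by (simp add: algebra_simps)
    finally show "char_inner (Hgrp TYPE('a) n) trivial_char (psi n k) =
        of_nat (qbinom TYPE('a) (int n) (int k - 1))"
      using q0 j(1) by simp
  next
    fix \<chi> k assume "irreducible_char (Hgrp TYPE('a) n) \<chi>
            \<and> \<not> (\<forall>g\<in>carrier (Hgrp TYPE('a) n). \<chi> g = trivial_char g)" and k: "k \<in> {1..n+1}"
    then have irr: "irreducible_char (Hgrp TYPE('a) n) \<chi>"
      and nontriv: "\<not> (\<forall>g\<in>carrier (Hgrp TYPE('a) n). \<chi> g = 1)"
      by (auto simp: trivial_char_def)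
    obtain j where j: "k = Suc j" "j \<le> n" using k by (cases k) auto
    note chi = irreducible_char_Hgrp[OF irr]
    \<comment> \<open>For \<open>n = 0\<close> the group is trivial, so no nontrivial irreducible
      character exists.\<close>
    have "n \<noteq> 0"
    proof
      assume "n = 0"
      then have "carrier_vec n = {0\<^sub>v n :: 'a vec}" by auto
      then show False using nontriv chi(1) by (simp add: Hgrp_carrier)
    qed
    then obtain m where m: "n = Suc m" by (cases n) auto
    \<comment> \<open>The character sum vanishes, leaving \<open>(N - M) / q^j\<close>, and
      \<open>qbinom_pascal\<close> shows that \<open>N - M\<close> is \<open>q^j\<close> times the
      claimed value.\<close>
    show "char_inner (Hgrp TYPE('a) n) \<chi> (psi n k) = of_nat (qbinom TYPE('a) (int n - 1) (int k - 1))"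
      using char_inner_psi[where \<chi> = \<chi>, OF j(2) chi(1)] chi(2)[OF nontriv] qbinom_pascal[of m j, where 'a='a] q0 m j(1)
      by (simp del: cnj_sum)
  next
    fix k :: nat assume "n \<ge> 1 \<and> k \<ge> 1"
    then obtain m j where "n = Suc m" "k = Suc j" by (cases n; cases k) auto
    then show "int (qbinom TYPE('a) (int n + 1) (int k)) =
          int (qbinom TYPE('a) (int n) (int k))
          + int (qbinom TYPE('a) (int n) (int k - 1))
          + (int q ^ n - 1) * int (qbinom TYPE('a) (int n - 1) (int k - 1))"
      using num_subspaces_goldman_rota[of m j, where 'a='a] qbinom_nat[of "Suc (Suc m)" "Suc j", where 'a='a]
        qbinom_nat[of "Suc m" "Suc j", where 'a='a] qbinom_nat[of "Suc m" j, where 'a='a]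
        qbinom_nat[of m j, where 'a='a] q
      by (simp add: add.commute)
  next
    fix k :: nat
    \<comment> \<open>For \<open>k > 0\<close> the zero space has no subspace of dimension
      \<open>k\<close>.\<close>
    show "qbinom TYPE('a) 0 (int k) = (if k = 0 then 1 else 0)"
      using subspaces_of_dim_empty[of 0 k, where 'a='a]
      by (simp add: qbinom_def subspaces_of_dim_0)
  next
    show "qbinom TYPE('a) (int n) 0 = 1"
      by (simp add: qbinom_def subspaces_of_dim_0)
  }
qed

end
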